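(* Let $K, L \subset \mathbb{R}^d$ be convex bodies containing the origin in their interiors with $K \subseteq L$, and let $F$ be a linear subspace of $\mathbb{R}^d$. Assume that $K$ is a largest-volume member of $\mathcal{A}_F(K)$ contained in $L$, i.e. $\mathrm{vol}(K)\ge \mathrm{vol}(K')$ for every $K'\in\mathcal{A}_F(K)$ with $K'\subseteq L$. Then there exist contact pairs $(v_1,p_1),\dots,(v_m,p_m)$ of $K$ and $L$ and positive weights $\alpha_1,\dots,\alpha_m$ such that \[ P_F\Big(\sum_{i=1}^m \alpha_i\, p_i\otimes v_i\Big)P_F = P_F,\qquad \sum_{i=1}^m \alpha_i p_i = 0,\qquad \operatorname{tr}\Big(\sum_{i=1}^m \alpha_i\, p_i\otimes v_i\Big)=\sum_{i=1}^m\alpha_i = d. \]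
   Context: A convex body is a compact convex set with nonempty interior. For a linear subspace $F\subseteq\mathbb{R}^d$, an $F$-operator is an invertible linear operator $A$ on $\mathbb{R}^d$ such that $F$ and $F^\perp$ are invariant subspaces of $A$ and the restriction of $A$ to $F^\perp$ is a nonzero multiple of the identity on $F^\perp$. For $S\subseteq\mathbb{R}^d$, $\mathcal{A}_F(S)=\{AS+z:\ A \text{ an } F\text{-operator},\ z\in\mathbb{R}^d\}$. $P_F$ denotes orthogonal projection onto $F$. The polar of a set $S$ is $S^\circ=\{p:\ \langle x,p\rangle\le 1\ \forall x\in S\}$. For convex bodies $K\subseteq L$, a contact pair of $K$ and $L$ is a pair $(v,p)\in\mathbb{R}^d\times\mathbb{R}^d$ with $v\in\partial K\cap\partial L$, $p\in\partial K^\circ\cap\partial L^\circ$, and $\langle p,v\rangle=1$ (so $p$ is a suitably normalized outer normal of a common supporting hyperplane of $K$ and $L$ at $v$). For vectors $p,v$, $p\otimes v$ is the linear operator $x\mapsto\langle v,x\rangle p$. *)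

theory Defs
  imports "HOL-Analysis.Analysis"
begin

text \<open>Convex body: compact convex set with nonempty interior.\<close>
definition convex_body :: "(real^'n) set \<Rightarrow> bool" where
  "convex_body K \<longleftrightarrow> compact K \<and> convex K \<and> interior K \<noteq> {}"

text \<open>Orthogonal complement of a set.\<close>
definition orth_compl :: "(real^'n) set \<Rightarrow> (real^'n) set" where
  "orth_compl F = {y. \<forall>x\<in>F. x \<bullet> y = 0}"

text \<open>F-operator (as a matrix acting by *v).\<close>
definition F_operator :: "(real^'n) set \<Rightarrow> real^'n^'n \<Rightarrow> bool" where
  "F_operator F A \<longleftrightarrow> invertible A \<and> (\<forall>x\<in>F. A *v x \<in> F)
     \<and> (\<forall>y\<in>orth_compl F. A *v y \<in> orth_compl F)
     \<and> (\<exists>c::real. c \<noteq> 0 \<and> (\<forall>y\<in>orth_compl F. A *v y = c *\<^sub>R y))"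

text \<open>The family A_F(S).\<close>
definition A_F :: "(real^'n) set \<Rightarrow> (real^'n) set \<Rightarrow> (real^'n) set set" where
  "A_F F S = {(\<lambda>x. A *v x + z) ` S | A z. F_operator F A}"

text \<open>Orthogonal projection onto the subspace F, as a matrix.\<close>
definition proj_F :: "(real^'n) set \<Rightarrow> real^'n^'n" where
  "proj_F F = matrix (\<lambda>x. THE y. y \<in> F \<and> (\<forall>z\<in>F. (x - y) \<bullet> z = 0))"

definition polar :: "(real^'n) set \<Rightarrow> (real^'n) set" where
  "polar S = {p. \<forall>x\<in>S. x \<bullet> p \<le> 1}"

definition contact_pair :: "(real^'n) set \<Rightarrow> (real^'n) set \<Rightarrow> real^'n \<Rightarrow> real^'n \<Rightarrow> bool" where
  "contact_pair K L v p \<longleftrightarrow> v \<in> frontier K \<inter> frontier L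
     \<and> p \<in> frontier (polar K) \<inter> frontier (polar L) \<and> p \<bullet> v = 1"

text \<open>p \<otimes> v : x \<mapsto> \<langle>v,x\<rangle> p, as a matrix.\<close>
definition tensor :: "real^'n \<Rightarrow> real^'n \<Rightarrow> real^'n^'n" where
  "tensor p v = (\<chi> i j. p $ i * v $ j)"

end

theory Submission
  imports Defs
begin

text \<open>Let \<open>P = P\<^sub>F\<close> and \<open>d\<close> be the dimension. For \<open>G\<close> preserving \<open>F\<close> and acting as a scalar
  on \<open>F\<^sup>\<bottom>\<close>, the maps \<open>x \<mapsto> x + e (G x + z)\<close> with small \<open>e > 0\<close> are affine F-operators, and
  they multiply volumes by \<open>det (1 + e G) > 1\<close> when \<open>trace G > 0\<close>; by maximality none of them
  keeps \<open>K\<close> inside \<open>L\<close>. By compactness such a map does keep \<open>K\<close> inside \<open>L\<close> as soon as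
  \<open>\<langle>p, G v + z\<rangle> < 0\<close> for every contact pair \<open>(v, p)\<close>. Hence \<open>(P/d, 0, 1)\<close> lies in the convex
  hull of the points \<open>(P (p \<otimes> v) P, p, 1)\<close>: a hyperplane separating it would provide such
  \<open>G\<close> and \<open>z\<close>. The coefficients of a convex combination, multiplied by \<open>d\<close>, are the weights.\<close>

section \<open>Orthogonal projection onto a subspace\<close>

definition orth_proj :: "(real^'n) set \<Rightarrow> real^'n \<Rightarrow> real^'n" where
  "orth_proj F x = (THE y. y \<in> F \<and> (\<forall>z\<in>F. (x - y) \<bullet> z = 0))"

lemma orth_proj_unique:
  assumes "subspace F" "y1 \<in> F" "\<forall>z\<in>F. (x - y1) \<bullet> z = 0" "y2 \<in> F" "\<forall>z\<in>F. (x - y2) \<bullet> z = 0"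
  shows "y1 = y2"
proof -
  have "y1 - y2 \<in> F"
    using assms by (simp add: subspace_diff)
  then have "(y1 - y2) \<bullet> (y1 - y2) = (x - y2) \<bullet> (y1 - y2) - (x - y1) \<bullet> (y1 - y2)"
    by (simp add: algebra_simps)
  also have "\<dots> = 0"
    using assms \<open>y1 - y2 \<in> F\<close> by simp
  finally show ?thesis
    by simp
qed

lemma orth_proj:
  fixes F :: "(real^'n) set"
  assumes "subspace F"
  shows "orth_proj F x \<in> F \<and> (\<forall>z\<in>F. (x - orth_proj F x) \<bullet> z = 0)"
proof -
  obtain y z where "y \<in> span F" "\<And>w. w \<in> span F \<Longrightarrow> orthogonal z w" "x = y + z"
    using orthogonal_subspace_decomp_exists by blast
  moreover have "span F = F"
    using assms by (simp add: span_eq_iff)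
  ultimately have "\<exists>y. y \<in> F \<and> (\<forall>z\<in>F. (x - y) \<bullet> z = 0)"
    by (intro exI[of _ y]) (auto simp: orthogonal_def)
  then have "\<exists>!y. y \<in> F \<and> (\<forall>z\<in>F. (x - y) \<bullet> z = 0)"
    using orth_proj_unique[OF assms] by blast
  then show ?thesis
    unfolding orth_proj_def by (rule theI')
qed

lemma orth_proj_eqI:
  assumes "subspace F" "y \<in> F" "\<forall>z\<in>F. (x - y) \<bullet> z = 0"
  shows "orth_proj F x = y"
  using orth_proj[OF assms(1)] orth_proj_unique[OF assms(1)] assms by blast

lemma linear_orth_proj:
  assumes "subspace F"
  shows "linear (orth_proj F)"
proof (rule linearI)
  fix x y
  show "orth_proj F (x + y) = orth_proj F x + orth_proj F y"
    using orth_proj[OF assms, of x] orth_proj[OF assms, of y]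
    by (intro orth_proj_eqI[OF assms])
       (auto simp: subspace_add[OF assms] algebra_simps inner_diff_left inner_add_left)
next
  fix c :: real and x
  show "orth_proj F (c *\<^sub>R x) = c *\<^sub>R orth_proj F x"
    using orth_proj[OF assms, of x]
    by (intro orth_proj_eqI[OF assms])
       (auto simp: subspace_scale[OF assms] simp flip: scaleR_right_diff_distrib)
qed

lemma proj_F_mult:
  assumes "subspace F"
  shows "proj_F F *v x = orth_proj F x"
proof -
  have "proj_F F = matrix (orth_proj F)"
    unfolding proj_F_def orth_proj_def ..
  then show ?thesis
    by (simp add: linear_orth_proj[OF assms])
qed

lemma proj_F_in: "subspace F \<Longrightarrow> proj_F F *v x \<in> F"
  by (simp add: proj_F_mult orth_proj)

lemma proj_F_fixes: "subspace F \<Longrightarrow> x \<in> F \<Longrightarrow> proj_F F *v x = x"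
  by (simp add: proj_F_mult orth_proj_eqI)

lemma proj_F_orth_compl: "subspace F \<Longrightarrow> y \<in> orth_compl F \<Longrightarrow> proj_F F *v y = 0"
  by (simp add: proj_F_mult orth_proj_eqI orth_compl_def subspace_0 inner_commute)

lemma proj_F_idem: "subspace F \<Longrightarrow> proj_F F ** proj_F F = proj_F F"
  by (simp add: matrix_eq proj_F_fixes proj_F_in flip: matrix_vector_mul_assoc)

lemma inner_orth_proj_commute:
  assumes "subspace F"
  shows "x \<bullet> orth_proj F y = orth_proj F x \<bullet> y"
proof -
  have "x \<bullet> orth_proj F y = orth_proj F x \<bullet> orth_proj F y"
    using orth_proj[OF assms, of x] orth_proj[OF assms, of y] by (simp add: inner_diff_left)
  also have "\<dots> = orth_proj F x \<bullet> y"
  proof -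
    have "(y - orth_proj F y) \<bullet> orth_proj F x = 0"
      using orth_proj[OF assms, of x] orth_proj[OF assms, of y] by blast
    then show ?thesis
      by (simp add: inner_diff_left inner_diff_right inner_commute)
  qed
  finally show ?thesis .
qed

lemma transpose_proj_F:
  assumes "subspace F"
  shows "transpose (proj_F F) = proj_F F"
proof -
  have "proj_F F $ i $ j = proj_F F $ j $ i" for i j
    using inner_orth_proj_commute[OF assms, of "axis i 1" "axis j 1"]
    by (simp add: proj_F_mult[OF assms, symmetric] matrix_vector_mult_basis column_def
                  inner_axis inner_axis')
  then show ?thesis
    by (simp add: transpose_def vec_eq_iff)
qed

section \<open>Rank-one matrices and the Frobenius inner product\<close>

lemma inner_tensor: "(X::real^'n^'n) \<bullet> tensor p v = p \<bullet> (X *v v)"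
  by (simp add: tensor_def inner_vec_def matrix_vector_mult_def sum_distrib_left algebra_simps)

lemma trace_tensor: "trace (tensor p v) = p \<bullet> v"
  by (simp add: trace_def tensor_def inner_vec_def)

lemma linear_trace: "linear (trace :: real^'n^'n \<Rightarrow> real)"
  by (rule linearI) (simp_all add: trace_def sum.distrib sum_distrib_left)

lemma matrix_mul_tensor: "(A::real^'n^'n) ** tensor p v = tensor (A *v p) v"
  by (simp add: tensor_def matrix_matrix_mult_def matrix_vector_mult_def vec_eq_iff
                sum_distrib_right mult.assoc)

lemma tensor_matrix_mul: "tensor p v ** (B::real^'n^'n) = tensor p (transpose B *v v)"
  by (simp add: tensor_def matrix_matrix_mult_def matrix_vector_mult_def transpose_def vec_eq_iff
                sum_distrib_left mult_ac)

lemma matrix_add_rdistrib: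
  fixes A B :: "'a::semiring_1^'n^'m" and C :: "'a^'p^'n"
  shows "(A + B) ** C = A ** C + B ** C"
  by (simp add: vec_eq_iff matrix_matrix_mult_def sum.distrib algebra_simps)

lemma linear_matrix_sandwich: "linear (\<lambda>X::real^'n^'n. A ** X ** B)"
  by (rule linearI)
     (simp_all add: matrix_add_ldistrib matrix_add_rdistrib scalar_matrix_assoc matrix_scalar_ac)

lemma inner_eq_trace: "(X::real^'n^'n) \<bullet> Y = trace (X ** transpose Y)"
  by (simp add: inner_vec_def trace_def matrix_matrix_mult_def transpose_def)

lemma inner_matrix_vector_transpose: "((A::real^'n^'m) *v x) \<bullet> y = x \<bullet> (transpose A *v y)"
  using dot_lmul_matrix[of x "transpose A" y] by (simp add: vector_transpose_matrix)

lemma inner_sandwich_tensor: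
  fixes H P :: "real^'n^'n"
  assumes "transpose P = P"
  shows "H \<bullet> (P ** tensor p v ** P) = p \<bullet> ((P ** H ** P) *v v)"
  using assms
  by (simp add: matrix_mul_tensor tensor_matrix_mul inner_tensor inner_matrix_vector_transpose
                matrix_vector_mul_assoc matrix_mul_assoc)

lemma inner_projection_eq_trace:
  fixes H P :: "real^'n^'n"
  assumes "transpose P = P" "P ** P = P"
  shows "H \<bullet> P = trace (P ** H ** P)"
proof -
  have "H \<bullet> P = trace ((H ** P) ** P)"
    using assms by (simp add: inner_eq_trace flip: matrix_mul_assoc)
  also have "\<dots> = trace (P ** H ** P)"
    by (simp add: trace_mul_sym[of "H ** P"] matrix_mul_assoc)
  finally show ?thesis .
qed

section \<open>Polar sets and contact pairs\<close>

lemma closed_polar: "closed (polar S)"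
proof -
  have "polar S = (\<Inter>x\<in>S. {p. x \<bullet> p \<le> 1})"
    by (auto simp: polar_def)
  then show ?thesis
    by (auto intro!: closed_INT closed_halfspace_le)
qed

lemma polar_antimono: "K \<subseteq> L \<Longrightarrow> polar L \<subseteq> polar K"
  by (auto simp: polar_def)

lemma bounded_polar:
  fixes L :: "(real^'n) set"
  assumes "0 \<in> interior L"
  shows "bounded (polar L)"
proof -
  obtain r where r: "r > 0" "ball 0 r \<subseteq> L"
    using assms mem_interior by blast
  have "norm p \<le> 2 / r" if "p \<in> polar L" for p
  proof (cases "p = 0")
    case False
    have "(r / 2 / norm p) *\<^sub>R p \<in> L"
      using r False by auto
    then have "(r / 2 / norm p) *\<^sub>R p \<bullet> p \<le> 1"
      using that by (auto simp: polar_def)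
    then have "r / 2 * norm p \<le> 1"
      using False by (simp add: power2_norm_eq_inner[symmetric] power2_eq_square)
    then show ?thesis
      using r by (simp add: field_simps)
  qed (use r in simp)
  then show ?thesis
    by (auto simp: bounded_iff)
qed

lemma compact_polar: "0 \<in> interior L \<Longrightarrow> compact (polar L)"
  by (simp add: compact_eq_bounded_closed closed_polar bounded_polar)

text \<open>A closed convex set containing the origin is its own bipolar.\<close>
lemma not_in_closed_convex_imp_polar:
  fixes L :: "(real^'n) set"
  assumes "convex L" "closed L" "0 \<in> L" "y \<notin> L"
  obtains p where "p \<in> polar L" "y \<bullet> p > 1"
proof -
  obtain a b where ab: "a \<bullet> y < b" "\<forall>x\<in>L. b < a \<bullet> x"
    using separating_hyperplane_closed_point[OF assms(1,2,4)] by blast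
  have "b < 0"
    using ab assms(3) by force
  have inner_eq: "x \<bullet> (a /\<^sub>R b) = (a \<bullet> x) / b" for x
    by (simp add: inner_commute divide_inverse_commute)
  have "x \<bullet> (a /\<^sub>R b) \<le> 1" if "x \<in> L" for x
    unfolding inner_eq using ab that \<open>b < 0\<close> by (simp add: divide_le_eq less_imp_le)
  moreover have "y \<bullet> (a /\<^sub>R b) > 1"
    unfolding inner_eq using ab \<open>b < 0\<close> by (simp add: less_divide_eq)
  ultimately show thesis
    using that[of "a /\<^sub>R b"] by (auto simp: polar_def)
qed

lemma scaleR_gt_1_in_interior:
  fixes b :: "'a::real_normed_vector"
  assumes "b \<in> interior B" "b \<noteq> 0"
  obtains t where "t > 1" "t *\<^sub>R b \<in> B"
proof -
  obtain e where e: "e > 0" "ball b e \<subseteq> B"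
    using assms mem_interior by blast
  let ?t = "1 + e / 2 / norm b"
  have "dist b (?t *\<^sub>R b) = e / 2"
    using assms e by (simp add: dist_norm algebra_simps)
  then have "?t *\<^sub>R b \<in> B"
    using e by auto
  then show thesis
    using that[of ?t] e assms by auto
qed

lemma contact_pairI:
  fixes K L :: "(real^'n) set"
  assumes "closed K" "K \<subseteq> L" "x \<in> K" "p \<in> polar L" "x \<bullet> p = 1"
  shows "contact_pair K L x p"
proof -
  have "x \<noteq> 0" "p \<noteq> 0"
    using assms(5) by auto
  have "x \<notin> interior L"
  proof
    assume "x \<in> interior L"
    then obtain t where "t > 1" "t *\<^sub>R x \<in> L"
      using scaleR_gt_1_in_interior \<open>x \<noteq> 0\<close> by blast
    then show False
      using assms(4,5) by (auto simp: polar_def)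
  qed
  moreover have "p \<notin> interior (polar K)"
  proof
    assume "p \<in> interior (polar K)"
    then obtain t where "t > 1" "t *\<^sub>R p \<in> polar K"
      using scaleR_gt_1_in_interior \<open>p \<noteq> 0\<close> by blast
    then show False
      using assms(3,5) by (auto simp: polar_def)
  qed
  moreover have "p \<in> polar K"
    using polar_antimono[OF assms(2)] assms(4) by blast
  ultimately show ?thesis
    using assms closure_subset[of L] closure_subset[of "polar K"] closure_subset[of "polar L"]
      interior_mono[OF assms(2)] interior_mono[OF polar_antimono[OF assms(2)]]
      closure_closed[OF closed_polar]
    by (auto simp: contact_pair_def frontier_def inner_commute)
qed

lemma compact_contact_pairs:
  fixes K L :: "(real^'n) set"
  assumes "compact K" "0 \<in> interior L"
  shows "compact {(v, p). contact_pair K L v p}"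
proof -
  have eq: "{(v, p). contact_pair K L v p}
      = ((frontier K \<inter> frontier L) \<times> (frontier (polar K) \<inter> frontier (polar L)))
        \<inter> {vp. snd vp \<bullet> fst vp = 1}"
    by (auto simp: contact_pair_def)
  have "closed {(v, p). contact_pair K L v p}"
    unfolding eq by (intro closed_Int closed_Times frontier_closed closed_Collect_eq continuous_intros)
  moreover have "{(v, p). contact_pair K L v p} \<subseteq> K \<times> polar L"
    using frontier_subset_closed[OF compact_imp_closed[OF assms(1)]]
      frontier_subset_closed[OF closed_polar[of L]]
    by (auto simp: contact_pair_def)
  moreover have "compact (K \<times> polar L)"
    using assms by (simp add: compact_Times compact_polar)
  ultimately show ?thesis
    using compact_Int_closed[of "K \<times> polar L"] by (metis inf.absorb_iff2)
qed

section \<open>Perturbations keeping \<open>K\<close> inside \<open>L\<close>\<close>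

lemma compact_perturbation_bound:
  fixes f g :: "'a::metric_space \<Rightarrow> real"
  assumes S: "compact S" and f: "continuous_on S f" and g: "continuous_on S g"
    and g_le: "\<forall>s\<in>S. g s \<le> 1" and f_neg: "\<forall>s\<in>S. g s = 1 \<longrightarrow> f s < 0"
  shows "\<exists>e0>0. \<forall>e. 0 < e \<and> e \<le> e0 \<longrightarrow> (\<forall>s\<in>S. g s + e * f s \<le> 1)"
proof -
  define S' where "S' = S \<inter> f -` {0..}"
  have "closed S'"
    unfolding S'_def using S f by (intro continuous_closed_preimage) (auto simp: compact_imp_closed)
  then have "compact S'"
    using compact_Int_closed[OF S] by (metis S'_def Int_left_absorb)
  obtain \<eta> where \<eta>: "\<eta> > 0" "\<forall>s\<in>S'. g s \<le> 1 - \<eta>"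
  proof (cases "S' = {}")
    case False
    obtain s0 where s0: "s0 \<in> S'" "\<forall>s\<in>S'. g s \<le> g s0"
      using continuous_attains_sup[OF \<open>compact S'\<close> False] g by (auto simp: S'_def intro: continuous_on_subset)
    then have "g s0 < 1"
      using g_le f_neg by (force simp: S'_def)
    then show thesis
      using that[of "1 - g s0"] s0 by auto
  qed (use that[of 1] in auto)
  obtain M where M: "M > 0" "\<forall>s\<in>S. f s \<le> M"
  proof -
    obtain B where "\<forall>s\<in>S. norm (f s) \<le> B"
      using compact_imp_bounded[OF compact_continuous_image[OF f S]] by (auto simp: bounded_iff)
    then show thesis
      using that[of "max 1 B"] by force
  qed
  have "g s + e * f s \<le> 1" if e: "0 < e" "e \<le> \<eta> / M" and "s \<in> S" for e s
  proof (cases "f s < 0")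
    case True
    then have "e * f s < 0"
      using e(1) by (simp add: mult_pos_neg)
    then show ?thesis
      using g_le \<open>s \<in> S\<close> by fastforce
  next
    case False
    then have "g s \<le> 1 - \<eta>"
      using \<eta> \<open>s \<in> S\<close> by (simp add: S'_def)
    moreover have "e * f s \<le> \<eta> / M * M"
      using e M \<open>s \<in> S\<close> False by (intro mult_mono) auto
    ultimately show ?thesis
      using M by simp
  qed
  then show ?thesis
    using \<eta> M by (intro exI[of _ "\<eta> / M"]) auto
qed

lemma perturbation_stays_inside:
  fixes K L :: "(real^'n) set" and G :: "real^'n^'n"
  assumes K: "compact K" and L: "compact L" "convex L" "0 \<in> interior L" and "K \<subseteq> L"
    and contact: "\<And>v p. contact_pair K L v p \<Longrightarrow> p \<bullet> (G *v v + z) < 0"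
  shows "\<exists>e0>0. \<forall>e. 0 < e \<and> e \<le> e0 \<longrightarrow> (\<lambda>x. x + e *\<^sub>R (G *v x + z)) ` K \<subseteq> L"
proof -
  define f where "f = (\<lambda>(x, p). p \<bullet> (G *v x + z))"
  define g where "g = (\<lambda>(x::real^'n, p). x \<bullet> p)"
  have "continuous_on (K \<times> polar L) f"
    unfolding f_def case_prod_unfold
    by (intro continuous_intros linear_continuous_on
          bounded_linear_compose[OF matrix_vector_mul_bounded_linear bounded_linear_fst])
  moreover have "continuous_on (K \<times> polar L) g"
    unfolding g_def case_prod_unfold by (intro continuous_intros)
  moreover have "\<forall>s\<in>K \<times> polar L. g s \<le> 1"
    using \<open>K \<subseteq> L\<close> by (auto simp: g_def polar_def)
  moreover have "\<forall>s\<in>K \<times> polar L. g s = 1 \<longrightarrow> f s < 0"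
    using contact contact_pairI[OF compact_imp_closed[OF K] \<open>K \<subseteq> L\<close>] by (auto simp: f_def g_def)
  ultimately obtain e0 where e0: "e0 > 0"
      "\<forall>e. 0 < e \<and> e \<le> e0 \<longrightarrow> (\<forall>s\<in>K \<times> polar L. g s + e * f s \<le> 1)"
    using compact_perturbation_bound[of "K \<times> polar L" f g] K compact_polar[OF L(3)]
    by (auto simp: compact_Times)
  have "x + e *\<^sub>R (G *v x + z) \<in> L" if e: "0 < e" "e \<le> e0" and "x \<in> K" for e x
  proof (rule ccontr)
    assume "x + e *\<^sub>R (G *v x + z) \<notin> L"
    then obtain p where "p \<in> polar L" "(x + e *\<^sub>R (G *v x + z)) \<bullet> p > 1"
      using not_in_closed_convex_imp_polar L interior_subset compact_imp_closed by blast
    moreover have "(x + e *\<^sub>R (G *v x + z)) \<bullet> p = g (x, p) + e * f (x, p)"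
      by (simp add: f_def g_def inner_add_left inner_add_right inner_commute)
    ultimately show False
      using e0 e \<open>x \<in> K\<close> by fastforce
  qed
  then show ?thesis
    using e0(1) by blast
qed

section \<open>Volume growth under perturbations of the identity\<close>

text \<open>Only the identity permutation contributes to the derivative: every other one has at
  least two off-diagonal factors, so each product rule term keeps one factor equal to zero at 0.\<close>
lemma has_field_derivative_det_id_plus:
  fixes G :: "real^'n^'n"
  shows "((\<lambda>e. det (mat 1 + e *\<^sub>R G)) has_field_derivative trace G) (at 0)"
proof -
  let ?M = "\<lambda>e::real. mat 1 + e *\<^sub>R G"
  let ?d = "\<lambda>p. of_int (sign p) * (\<Sum>x\<in>UNIV. G$x$(p x) * (\<Prod>y\<in>UNIV-{x}. ?M 0 $ y $ p y))"
  have D: "((\<lambda>e. det (?M e)) has_field_derivative (\<Sum>p\<in>{p. p permutes UNIV}. ?d p)) (at 0)"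
    unfolding det_def
    by (intro DERIV_sum DERIV_cmult has_field_derivative_prod) (auto intro!: derivative_eq_intros)
  have "?d p = 0" if "p permutes UNIV" "p \<noteq> id" for p
  proof -
    have off_diagonal: "(\<Prod>y\<in>UNIV-{x}. mat 1 $ y $ p y) = (0::real)" for x
    proof -
      obtain y where "y \<noteq> x" "p y \<noteq> y"
        using \<open>p \<noteq> id\<close> permutes_inj[OF \<open>p permutes UNIV\<close>]
        by (metis eq_id_iff injD)
      then show ?thesis
        by (auto simp: mat_def intro!: prod_zero bexI[of _ y])
    qed
    then show ?thesis
      by (simp add: off_diagonal)
  qed
  then have "(\<Sum>p\<in>{p. p permutes UNIV}. ?d p) = ?d id"
    using sum.mono_neutral_left[of "{p. p permutes UNIV}" "{id}" ?d]
    by (simp add: finite_permutations permutes_id)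
  also have "?d id = trace G"
    by (simp add: trace_def mat_def sign_id)
  finally show ?thesis
    using D by simp
qed

lemma det_id_plus_gt_1:
  fixes G :: "real^'n^'n"
  assumes "trace G > 0"
  obtains d where "d > 0" "\<And>e. 0 < e \<Longrightarrow> e < d \<Longrightarrow> det (mat 1 + e *\<^sub>R G) > 1"
  using DERIV_pos_inc_right[OF has_field_derivative_det_id_plus assms] by (auto simp: det_I)

text \<open>The library computes the volume of linear images (\<open>measure_linear_image\<close>) only for
  index types of class \<open>wellorder\<close>. A copy of a finite index type carries a well-order, and
  relabelling the coordinates along the copy preserves Lebesgue measure and traces.\<close>

typedef ('a::finite) ordered_index = "UNIV :: 'a set"
  by simp

instantiation ordered_index :: (finite) linorder
begin

definition less_eq_ordered_index :: "'a ordered_index \<Rightarrow> 'a ordered_index \<Rightarrow> bool" where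
  "x \<le> y \<longleftrightarrow> to_nat (Rep_ordered_index x) \<le> to_nat (Rep_ordered_index y)"

definition less_ordered_index :: "'a ordered_index \<Rightarrow> 'a ordered_index \<Rightarrow> bool" where
  "x < y \<longleftrightarrow> to_nat (Rep_ordered_index x) < to_nat (Rep_ordered_index y)"

instance
  by standard (auto simp: less_eq_ordered_index_def less_ordered_index_def Rep_ordered_index_inject)

end

instance ordered_index :: (finite) finite
proof
  have "UNIV = Abs_ordered_index ` UNIV"
    by (metis Abs_ordered_index_cases surj_def)
  then show "finite (UNIV :: 'a ordered_index set)"
    by (metis finite finite_imageI)
qed

instance ordered_index :: (finite) wellorder
proof
  fix P :: "'a ordered_index \<Rightarrow> bool" and a
  assume step: "\<And>x. (\<And>y. y < x \<Longrightarrow> P y) \<Longrightarrow> P x"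
  show "P a"
  proof (induct "to_nat (Rep_ordered_index a)" arbitrary: a rule: less_induct)
    case less
    then show ?case
      by (metis step less_ordered_index_def)
  qed
qed

lemma prod_Basis_vec: "(\<Prod>b\<in>(Basis :: (real^'n) set). f b) = (\<Prod>i\<in>UNIV. f (axis i 1))"
proof -
  have "(Basis :: (real^'n) set) = range (\<lambda>i. axis i 1)"
    by (auto simp: Basis_vec_def)
  moreover have "inj (\<lambda>i::'n. axis i (1::real))"
    by (auto intro!: injI simp: axis_eq_axis)
  ultimately show ?thesis
    using prod.reindex[of "\<lambda>i::'n. axis i (1::real)" UNIV f] by simp
qed

lemma linear_reindex: "linear (\<lambda>x::real^'n. \<chi> i. x $ r i)"
  by (rule linearI) (simp_all add: vec_eq_iff)

lemma borel_measurable_reindex: "(\<lambda>x::real^'n. \<chi> i. x $ r i) \<in> borel_measurable borel"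
  by (intro borel_measurable_continuous_onI linear_continuous_on linear_conv_bounded_linear[THEN iffD1]
        linear_reindex)

lemma lborel_distr_reindex:
  fixes r :: "'m::finite \<Rightarrow> 'n::finite"
  assumes "bij r"
  shows "distr lborel borel (\<lambda>x::real^'n. \<chi> i. x $ r i) = (lborel :: (real^'m) measure)"
proof (rule lborel_eqI[symmetric])
  fix l u :: "real^'m"
  assume le: "\<And>b. b \<in> Basis \<Longrightarrow> l \<bullet> b \<le> u \<bullet> b"
  have lu: "l $ i \<le> u $ i" for i
    using le[of "axis i 1"] by (simp add: inner_axis)
  define R' where "R' = (\<lambda>y::real^'m. \<chi> j. y $ inv r j)"
  have "(\<lambda>x::real^'n. \<chi> i. x $ r i) -` box l u = box (R' l) (R' u)"
    using assms by (auto simp: mem_box_cart R'_def bij_inv_eq_iff) (metis bij_inv_eq_iff)+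
  then have "emeasure (distr lborel borel (\<lambda>x::real^'n. \<chi> i. x $ r i)) (box l u)
      = emeasure lborel (box (R' l) (R' u))"
    by (simp add: emeasure_distr borel_measurable_reindex)
  also have "\<dots> = (\<Prod>b\<in>Basis. (R' u - R' l) \<bullet> b)"
    by (rule emeasure_lborel_box) (auto simp: Basis_vec_def inner_axis R'_def lu)
  also have "\<dots> = (\<Prod>j\<in>UNIV. u $ inv r j - l $ inv r j)"
    by (simp add: prod_Basis_vec inner_axis R'_def)
  also have "\<dots> = (\<Prod>i\<in>UNIV. u $ i - l $ i)"
    using prod.reindex_bij_betw[OF bij_betw_inv_into[OF assms], of "\<lambda>i. u $ i - l $ i"] by simp
  also have "\<dots> = (\<Prod>b\<in>Basis. (u - l) \<bullet> b)"
    by (simp add: prod_Basis_vec inner_axis)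
  finally show "emeasure (distr lborel borel (\<lambda>x::real^'n. \<chi> i. x $ r i)) (box l u) = \<dots>" .
qed simp

lemma measure_reindex_image:
  fixes r :: "'m::finite \<Rightarrow> 'n::finite"
  assumes r: "bij r" and S: "S \<in> sets borel"
  shows "measure lebesgue ((\<lambda>x::real^'n. \<chi> i. x $ r i) ` S) = measure lebesgue S"
proof -
  define R where "R = (\<lambda>x::real^'n. \<chi> i. x $ r i)"
  define R' where "R' = (\<lambda>y::real^'m. \<chi> j. y $ inv r j)"
  have R'_R: "R' (R x) = x" for x
    using r by (simp add: R_def R'_def vec_eq_iff bij_is_surj surj_f_inv_f)
  have R_R': "R (R' y) = y" for y
    using r by (simp add: R_def R'_def vec_eq_iff bij_is_inj)
  have "R ` S = R' -` S"
  proof (intro set_eqI iffI)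
    show "y \<in> R' -` S" if "y \<in> R ` S" for y
      using that R'_R by auto
    show "y \<in> R ` S" if "y \<in> R' -` S" for y
      using that R_R' by (metis image_eqI vimageD)
  qed
  then have RS: "R ` S \<in> sets borel"
    using measurable_sets_borel[OF borel_measurable_reindex S] by (simp add: R'_def)
  have "inj R"
    by (metis R'_R injI)
  have "measure lebesgue (R ` S) = measure (distr lborel borel R) (R ` S)"
    using RS by (simp add: R_def lborel_distr_reindex[OF r] measure_completion)
  also have "\<dots> = measure lborel S"
    using RS \<open>inj R\<close> by (simp add: measure_distr R_def borel_measurable_reindex inj_vimage_image_eq)
  finally show ?thesis
    using S by (simp add: R_def measure_completion)
qed

lemma matrix_vector_mult_reindex:
  fixes r :: "'m::finite \<Rightarrow> 'n::finite" and A :: "real^'n^'n"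
  assumes "bij r"
  shows "(\<chi> i. (A *v x) $ r i) = (\<chi> i j. A $ r i $ r j) *v (\<chi> i. x $ r i)"
proof -
  have "(\<Sum>j\<in>UNIV. A $ r i $ r j * x $ r j) = (\<Sum>k\<in>UNIV. A $ r i $ k * x $ k)" for i
    using sum.reindex_bij_betw[OF assms, of "\<lambda>k. A $ r i $ k * x $ k"] .
  then show ?thesis
    by (simp add: vec_eq_iff matrix_vector_mult_def)
qed

lemma trace_reindex:
  fixes r :: "'m::finite \<Rightarrow> 'n::finite" and A :: "real^'n^'n"
  assumes "bij r"
  shows "trace (\<chi> i j. A $ r i $ r j) = trace A"
  using sum.reindex_bij_betw[OF assms] by (simp add: trace_def)

lemma bij_Rep_ordered_index: "bij Rep_ordered_index"
  by (metis Abs_ordered_index_inverse Rep_ordered_index_inject UNIV_I bijI injI surjI)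

lemma measure_id_plus_image_gt:
  fixes G :: "real^'n^'n" and K :: "(real^'n) set"
  assumes "trace G > 0" "compact K" "measure lebesgue K > 0"
  obtains d where "d > 0"
    "\<And>e. 0 < e \<Longrightarrow> e < d \<Longrightarrow>
      measure lebesgue ((\<lambda>x. (mat 1 + e *\<^sub>R G) *v x) ` K) > measure lebesgue K"
proof -
  define r where "r = (Rep_ordered_index :: 'n ordered_index \<Rightarrow> 'n)"
  have r: "bij r"
    by (simp add: r_def bij_Rep_ordered_index)
  define R where "R = (\<lambda>x::real^'n. \<chi> i. x $ r i)"
  define G' where "G' = (\<chi> i j. G $ r i $ r j)"
  have "trace G' > 0"
    using assms(1) by (simp add: G'_def trace_reindex[OF r])
  then obtain d where "d > 0" and d: "\<And>e. 0 < e \<Longrightarrow> e < d \<Longrightarrow> det (mat 1 + e *\<^sub>R G') > 1"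
    using det_id_plus_gt_1 by blast
  have "measure lebesgue ((\<lambda>x. (mat 1 + e *\<^sub>R G) *v x) ` K) > measure lebesgue K"
    if "0 < e" "e < d" for e
  proof -
    define A where "A = mat 1 + e *\<^sub>R G"
    define A' where "A' = mat 1 + e *\<^sub>R G'"
    have "A' = (\<chi> i j. A $ r i $ r j)"
      using r by (simp add: A_def A'_def G'_def mat_def vec_eq_iff bij_is_inj inj_eq)
    then have "R (A *v x) = A' *v R x" for x
      by (simp add: R_def matrix_vector_mult_reindex[OF r])
    then have image_eq: "R ` ((*v) A ` K) = (*v) A' ` (R ` K)"
      by (simp add: image_image)
    have "compact ((*v) A ` K)" "compact (R ` K)"
      using assms(2) linear_reindex[of r]
      by (auto intro!: compact_continuous_image linear_continuous_on
            simp: R_def linear_conv_bounded_linear[symmetric])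
    have "measure lebesgue ((*v) A ` K) = measure lebesgue (R ` ((*v) A ` K))"
      using measure_reindex_image[OF r borel_compact[OF \<open>compact ((*v) A ` K)\<close>]]
      by (simp add: R_def)
    also have "\<dots> = \<bar>det A'\<bar> * measure lebesgue (R ` K)"
      using measure_linear_image[OF matrix_vector_mul_linear lmeasurable_compact[OF \<open>compact (R ` K)\<close>]]
      by (simp add: image_eq)
    also have "\<dots> = \<bar>det A'\<bar> * measure lebesgue K"
      using measure_reindex_image[OF r borel_compact[OF assms(2)]] by (simp add: R_def)
    finally show ?thesis
      using d[OF that] assms(3) by (simp add: A_def A'_def)
  qed
  with \<open>d > 0\<close> that show thesis
    by blast
qed

section \<open>Largest-volume positions\<close>

lemma subspace_orth_compl: "subspace (orth_compl F)"
  unfolding subspace_def orth_compl_def by (auto simp: inner_add_right)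

lemma F_operatorI:
  assumes A: "invertible A" and "\<forall>x\<in>F. A *v x \<in> F"
    and scal: "\<forall>y\<in>orth_compl F. A *v y = c *\<^sub>R y"
  shows "F_operator F A"
proof -
  have "\<exists>c. c \<noteq> 0 \<and> (\<forall>y\<in>orth_compl F. A *v y = c *\<^sub>R y)"
  proof (cases "c = 0")
    case True
    have "y = 0" if "y \<in> orth_compl F" for y
    proof -
      obtain B where "B ** A = mat 1"
        using A invertible_left_inverse by blast
      then have "y = B *v (A *v y)"
        by (simp add: matrix_vector_mul_assoc)
      then show ?thesis
        using scal that True by simp
    qed
    then show ?thesis
      by (metis matrix_vector_mult_0_right scaleR_one zero_neq_one)
  qed (use scal in blast)
  then show ?thesis
    using assms subspace_orth_compl[of F] by (auto simp: F_operator_def subspace_scale)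
qed

lemma measure_convex_body_pos:
  fixes K :: "(real^'n) set"
  assumes "convex_body K"
  shows "measure lebesgue K > 0"
proof -
  obtain c r where "r > 0" "ball c r \<subseteq> K"
    using assms by (auto simp: convex_body_def mem_interior)
  moreover have "K \<in> lmeasurable"
    using assms by (simp add: convex_body_def lmeasurable_compact)
  ultimately have "measure lebesgue (ball c r) \<le> measure lebesgue K"
    by (intro measure_mono_fmeasurable) auto
  moreover have "measure lebesgue (ball c r) > 0"
    using content_ball_pos[OF \<open>r > 0\<close>] by (simp add: measure_completion)
  ultimately show ?thesis
    by linarith
qed

lemma maximal_volume_contact_condition:
  fixes K L F :: "(real^'n) set" and G :: "real^'n^'n"
  assumes K: "convex_body K" and L: "convex_body L" "0 \<in> interior L" and "K \<subseteq> L"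
    and "subspace F"
    and max: "\<forall>K'\<in>A_F F K. K' \<subseteq> L \<longrightarrow> measure lebesgue K' \<le> measure lebesgue K"
    and G_F: "\<forall>x\<in>F. G *v x \<in> F" and G_orth: "\<forall>y\<in>orth_compl F. G *v y = s *\<^sub>R y"
    and "trace G > 0"
  shows "\<exists>v p. contact_pair K L v p \<and> p \<bullet> (G *v v + z) \<ge> 0"
proof (rule ccontr)
  assume "\<nexists>v p. contact_pair K L v p \<and> p \<bullet> (G *v v + z) \<ge> 0"
  then obtain e0 where "e0 > 0"
    and e0: "\<And>e. 0 < e \<Longrightarrow> e \<le> e0 \<Longrightarrow> (\<lambda>x. x + e *\<^sub>R (G *v x + z)) ` K \<subseteq> L"
    using perturbation_stays_inside[of K L G z] K L \<open>K \<subseteq> L\<close>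
    by (force simp: convex_body_def not_le)
  obtain d1 where "d1 > 0" and d1: "\<And>e. 0 < e \<Longrightarrow> e < d1 \<Longrightarrow> det (mat 1 + e *\<^sub>R G) > 1"
    using det_id_plus_gt_1 \<open>trace G > 0\<close> by blast
  obtain d2 where "d2 > 0" and d2: "\<And>e. 0 < e \<Longrightarrow> e < d2 \<Longrightarrow>
      measure lebesgue ((\<lambda>x. (mat 1 + e *\<^sub>R G) *v x) ` K) > measure lebesgue K"
    using measure_id_plus_image_gt \<open>trace G > 0\<close> K measure_convex_body_pos[OF K]
    by (metis convex_body_def)
  define e where "e = min e0 (min d1 d2 / 2)"
  define A where "A = mat 1 + e *\<^sub>R G"
  have "0 < e" "e \<le> e0" "e < d1" "e < d2"
    using \<open>e0 > 0\<close> \<open>d1 > 0\<close> \<open>d2 > 0\<close> by (auto simp: e_def)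
  then have "det A > 1"
    using d1 by (simp add: A_def)
  have A_mult: "A *v x = x + e *\<^sub>R (G *v x)" for x
    by (simp add: A_def matrix_vector_mult_add_rdistrib scaleR_matrix_vector_assoc)
  have "F_operator F A"
  proof (rule F_operatorI)
    show "invertible A"
      using \<open>det A > 1\<close> invertible_det_nz by force
    show "\<forall>x\<in>F. A *v x \<in> F"
      using G_F \<open>subspace F\<close> by (simp add: A_mult subspace_add subspace_scale)
    show "\<forall>y\<in>orth_compl F. A *v y = (1 + e * s) *\<^sub>R y"
      using G_orth by (simp add: A_mult algebra_simps)
  qed
  define K' where "K' = (\<lambda>x. A *v x + e *\<^sub>R z) ` K"
  have "K' \<in> A_F F K"
    unfolding A_F_def K'_def using \<open>F_operator F A\<close> by blast
  moreover have "K' \<subseteq> L"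
    using e0[OF \<open>0 < e\<close> \<open>e \<le> e0\<close>] by (auto simp: K'_def A_mult algebra_simps)
  moreover have "K' = (+) (e *\<^sub>R z) ` ((*v) A ` K)"
    by (auto simp: K'_def add.commute)
  then have "measure lebesgue K' > measure lebesgue K"
    using d2[OF \<open>0 < e\<close> \<open>e < d2\<close>] by (simp add: measure_translation A_def)
  ultimately show False
    using max by force
qed

lemma convex_hull_image_positive_combination:
  fixes f :: "'a \<Rightarrow> 'b::real_vector"
  assumes "y \<in> convex hull (f ` C)"
  obtains m :: nat and c \<alpha> where "\<forall>i<m. c i \<in> C \<and> \<alpha> i > (0::real)" "(\<Sum>i<m. \<alpha> i) = 1"
    "(\<Sum>i<m. \<alpha> i *\<^sub>R f (c i)) = y"
proof -
  obtain S u where S: "finite S" "S \<subseteq> f ` C" "\<forall>x\<in>S. 0 \<le> u x" "sum u S = 1"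
    "(\<Sum>x\<in>S. u x *\<^sub>R x) = y"
    using assms unfolding convex_hull_explicit by blast
  define S' where "S' = {x\<in>S. u x > 0}"
  have "S' \<subseteq> S" "\<forall>x\<in>S - S'. u x = 0"
    using S(3) by (auto simp: S'_def)
  then have sums: "sum u S' = 1" "(\<Sum>x\<in>S'. u x *\<^sub>R x) = y"
    using S sum.mono_neutral_right[OF S(1)] by (metis (no_types, lifting) scale_eq_0_iff)+
  define g where "g = from_nat_into S'"
  have g: "bij_betw g {..<card S'} S'"
    using \<open>S' \<subseteq> S\<close> S(1) by (simp add: g_def bij_betw_from_nat_into_finite finite_subset)
  have "g i \<in> f ` C" if "i < card S'" for i
    using g that \<open>S' \<subseteq> S\<close> S(2) by (metis bij_betwE lessThan_iff subsetD)
  then have "\<forall>i<card S'. inv_into C f (g i) \<in> C \<and> u (g i) > 0"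
    "\<forall>i<card S'. f (inv_into C f (g i)) = g i"
    using g by (auto simp: inv_into_into f_inv_into_f bij_betw_def S'_def)
  then show thesis
    using that[of "card S'" "\<lambda>i. inv_into C f (g i)" "\<lambda>i. u (g i)"] sums
      sum.reindex_bij_betw[OF g, of u] sum.reindex_bij_betw[OF g, of "\<lambda>x. u x *\<^sub>R x"]
    by simp
qed

lemma scalar_minus_proj_F_sandwich:
  fixes H :: "real^'n^'n" and c :: real
  assumes "subspace F"
  defines "G \<equiv> c *\<^sub>R mat 1 - proj_F F ** H ** proj_F F"
  shows "\<forall>x\<in>F. G *v x \<in> F" and "\<forall>y\<in>orth_compl F. G *v y = c *\<^sub>R y"
proof -
  have G_mult: "G *v x = c *\<^sub>R x - proj_F F *v (H *v (proj_F F *v x))" for x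
    by (simp add: G_def matrix_vector_mult_diff_rdistrib matrix_vector_mul_assoc matrix_mul_assoc
        flip: scaleR_matrix_vector_assoc)
  show "\<forall>x\<in>F. G *v x \<in> F"
    using \<open>subspace F\<close> by (simp add: G_mult proj_F_in subspace_diff subspace_scale)
  show "\<forall>y\<in>orth_compl F. G *v y = c *\<^sub>R y"
    using \<open>subspace F\<close> by (simp add: G_mult proj_F_orth_compl)
qed

lemma closed_convex_hull_contact_image:
  fixes K L :: "(real^'n) set" and P :: "real^'n^'n"
  assumes "compact K" "0 \<in> interior L"
  shows "closed (convex hull
    ((\<lambda>(v, p). (P ** tensor p v ** P, p, 1::real)) ` {(v, p). contact_pair K L v p}))"
proof -
  have "continuous_on UNIV (\<lambda>(v, p). (P ** tensor p v ** P, p, 1::real))"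
    unfolding case_prod_unfold matrix_matrix_mult_def tensor_def by (intro continuous_intros)
  then show ?thesis
    using compact_contact_pairs[OF assms]
    by (meson compact_continuous_image compact_convex_hull compact_imp_closed continuous_on_subset
        subset_UNIV)
qed

lemma scaled_projection_in_contact_hull:
  fixes K L F :: "(real^'n) set"
  assumes K: "convex_body K" and L: "convex_body L" "0 \<in> interior L" and "K \<subseteq> L"
    and F: "subspace F"
    and max: "\<forall>K'\<in>A_F F K. K' \<subseteq> L \<longrightarrow> measure lebesgue K' \<le> measure lebesgue K"
  shows "((1 / real CARD('n)) *\<^sub>R proj_F F, 0, 1)
    \<in> convex hull ((\<lambda>(v, p). (proj_F F ** tensor p v ** proj_F F, p, 1::real)) ` {(v, p). contact_pair K L v p})"
    (is "?T \<in> convex hull (?\<Psi> ` ?C)")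
proof (rule ccontr)
  define P where "P = proj_F F"
  define d where "d = real CARD('n)"
  have "closed (convex hull (?\<Psi> ` ?C))"
    using K L(2) by (simp add: convex_body_def closed_convex_hull_contact_image)
  moreover assume "?T \<notin> convex hull (?\<Psi> ` ?C)"
  ultimately obtain a b where sep: "a \<bullet> ?T < b" "\<forall>x\<in>convex hull (?\<Psi> ` ?C). b < a \<bullet> x"
    using separating_hyperplane_closed_point[OF convex_convex_hull] by blast
  define H where "H = fst a"
  define w where "w = fst (snd a)"
  define c where "c = b - snd (snd a)"
  define G where "G = c *\<^sub>R mat 1 - P ** H ** P"
  have inner_a: "a \<bullet> (X, y, s) = H \<bullet> X + w \<bullet> y + snd (snd a) * s" for X y s
    by (simp add: H_def w_def inner_prod_def)
  have P: "transpose P = P" "P ** P = P"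
    using F by (simp_all add: P_def transpose_proj_F proj_F_idem)
  have "\<forall>x\<in>F. G *v x \<in> F" "\<forall>y\<in>orth_compl F. G *v y = c *\<^sub>R y"
    using scalar_minus_proj_F_sandwich[OF F, of c H] by (simp_all add: G_def P_def)
  moreover have "trace G > 0"
  proof -
    have "trace (P ** H ** P) / d < c"
      using sep(1) by (simp add: inner_a inner_projection_eq_trace[OF P] c_def d_def flip: P_def)
    then show ?thesis
      by (simp add: G_def trace_sub linear_scale[OF linear_trace] trace_I d_def divide_less_eq mult.commute)
  qed
  ultimately obtain v p where vp: "contact_pair K L v p" "p \<bullet> (G *v v - w) \<ge> 0"
    using maximal_volume_contact_condition[OF K L \<open>K \<subseteq> L\<close> F max, of G c "- w"] by auto
  have "?\<Psi> (v, p) \<in> convex hull (?\<Psi> ` ?C)"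
    using vp(1) by (intro hull_inc imageI) simp
  then have "b < a \<bullet> ?\<Psi> (v, p)"
    using sep(2) by blast
  also have "a \<bullet> ?\<Psi> (v, p) = p \<bullet> ((P ** H ** P) *v v) + w \<bullet> p + snd (snd a)"
    by (simp add: inner_a inner_sandwich_tensor[OF P(1)] flip: P_def)
  finally have "b < p \<bullet> ((P ** H ** P) *v v) + w \<bullet> p + snd (snd a)" .
  moreover have "p \<bullet> (G *v v - w) = c - p \<bullet> ((P ** H ** P) *v v) - w \<bullet> p"
    using vp(1) by (simp add: G_def contact_pair_def matrix_vector_mult_diff_rdistrib inner_diff_right
        inner_commute flip: scaleR_matrix_vector_assoc)
  ultimately show False
    using vp(2) by (simp add: c_def)
qed

lemma weights_from_projection_combination:
  fixes P :: "real^'n^'n" and v p :: "nat \<Rightarrow> real^'n"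
  defines "d \<equiv> real CARD('n)"
  assumes pv: "\<forall>i<m. p i \<bullet> v i = 1"
    and comb: "(\<Sum>i<m. \<beta> i *\<^sub>R (P ** tensor (p i) (v i) ** P, p i, 1::real)) = ((1 / d) *\<^sub>R P, 0, 1)"
  shows "P ** (\<Sum>i<m. (d * \<beta> i) *\<^sub>R tensor (p i) (v i)) ** P = P"
    and "(\<Sum>i<m. (d * \<beta> i) *\<^sub>R p i) = 0"
    and "trace (\<Sum>i<m. (d * \<beta> i) *\<^sub>R tensor (p i) (v i)) = d"
    and "(\<Sum>i<m. d * \<beta> i) = d"
proof -
  have "d > 0"
    by (simp add: d_def)
  have sum_sandwich: "(\<Sum>i<m. \<beta> i *\<^sub>R (P ** tensor (p i) (v i) ** P)) = (1 / d) *\<^sub>R P"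
    and sum_p: "(\<Sum>i<m. \<beta> i *\<^sub>R p i) = 0" and sum_\<beta>: "(\<Sum>i<m. \<beta> i) = 1"
    using arg_cong[OF comb, of fst] arg_cong[OF comb, of "\<lambda>x. fst (snd x)"]
      arg_cong[OF comb, of "\<lambda>x. snd (snd x)"]
    by (simp_all add: fst_sum snd_sum)
  have "P ** (\<Sum>i<m. (d * \<beta> i) *\<^sub>R tensor (p i) (v i)) ** P
      = d *\<^sub>R (\<Sum>i<m. \<beta> i *\<^sub>R (P ** tensor (p i) (v i) ** P))"
    by (simp add: linear_sum[OF linear_matrix_sandwich] linear_scale[OF linear_matrix_sandwich]
        scaleR_sum_right)
  then show "P ** (\<Sum>i<m. (d * \<beta> i) *\<^sub>R tensor (p i) (v i)) ** P = P"
    using \<open>d > 0\<close> by (simp add: sum_sandwich)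
  show "(\<Sum>i<m. (d * \<beta> i) *\<^sub>R p i) = 0"
    using sum_p by (simp flip: scaleR_scaleR scaleR_sum_right)
  show sum_d\<beta>: "(\<Sum>i<m. d * \<beta> i) = d"
    using sum_\<beta> by (simp flip: sum_distrib_left)
  have "trace (\<Sum>i<m. (d * \<beta> i) *\<^sub>R tensor (p i) (v i)) = (\<Sum>i<m. d * \<beta> i * (p i \<bullet> v i))"
    by (simp add: linear_sum[OF linear_trace] linear_scale[OF linear_trace] trace_tensor)
  also have "\<dots> = (\<Sum>i<m. d * \<beta> i)"
    using pv by (intro sum.cong) auto
  also have "\<dots> = d"
    by (rule sum_d\<beta>)
  finally show "trace (\<Sum>i<m. (d * \<beta> i) *\<^sub>R tensor (p i) (v i)) = d" .
qed

theorem mainTheorem1: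
  fixes K L F :: "(real^'n) set"
  assumes "convex_body K" and "convex_body L"
    and "0 \<in> interior K" and "0 \<in> interior L"
    and "K \<subseteq> L"
    and "subspace F"
    and "\<forall>K'\<in>A_F F K. K' \<subseteq> L \<longrightarrow> measure lebesgue K' \<le> measure lebesgue K"
  shows "\<exists>(m::nat) v p \<alpha>.
           (\<forall>i<m. contact_pair K L (v i) (p i) \<and> \<alpha> i > (0::real))
         \<and> proj_F F ** (\<Sum>i<m. \<alpha> i *\<^sub>R tensor (p i) (v i)) ** proj_F F = proj_F F
         \<and> (\<Sum>i<m. \<alpha> i *\<^sub>R p i) = 0
         \<and> trace (\<Sum>i<m. \<alpha> i *\<^sub>R tensor (p i) (v i)) = real CARD('n)
         \<and> (\<Sum>i<m. \<alpha> i) = real CARD('n)"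
proof -
  obtain m :: nat and c \<beta> where mem: "\<forall>i<m. c i \<in> {(v, p). contact_pair K L v p} \<and> \<beta> i > 0"
    and "(\<Sum>i<m. \<beta> i) = 1"
    and comb: "(\<Sum>i<m. \<beta> i *\<^sub>R (\<lambda>(v, p). (proj_F F ** tensor p v ** proj_F F, p, 1::real)) (c i))
      = ((1 / real CARD('n)) *\<^sub>R proj_F F, 0, 1)"
    by (rule convex_hull_image_positive_combination[OF scaled_projection_in_contact_hull[OF
        assms(1,2,4,5,6,7)]])
  define v where "v i = fst (c i)" for i
  define p where "p i = snd (c i)" for i
  have contact: "\<forall>i<m. contact_pair K L (v i) (p i) \<and> real CARD('n) * \<beta> i > 0"
    using mem by (simp add: case_prod_unfold v_def p_def)
  then have pv: "\<forall>i<m. p i \<bullet> v i = 1"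
    by (simp add: contact_pair_def)
  have "(\<Sum>i<m. \<beta> i *\<^sub>R (proj_F F ** tensor (p i) (v i) ** proj_F F, p i, 1::real))
      = ((1 / real CARD('n)) *\<^sub>R proj_F F, 0, 1)"
    using comb by (simp add: case_prod_unfold v_def p_def)
  note weights = weights_from_projection_combination[OF pv this]
  show ?thesis
    by (intro exI[of _ m] exI[of _ v] exI[of _ p] exI[of _ "\<lambda>i. real CARD('n) * \<beta> i"] conjI
        contact weights)
qed

end
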